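(* Let $(L,\mu_1,\mu_2,\delta_1,\delta_2)$ be a compatible AssDer pair. Let $T:L\to L$ be an endomorphism operator, i.e. a linear map with $T(\mu_i(x,y))=\mu_i(Tx,Ty)$ for $i\in\{1,2\}$ and all $x,y\in L$, such that for all $x\in L$ and $i\in\{1,2\}$ $$T^2x=Tx,\qquad T\circ\delta_i=\delta_i\circ T.$$ Then $(L,[\cdot,\cdot]_1,[\cdot,\cdot]_2,\delta_1,\delta_2)$ is a compatible LieDer pair, where $$[x,y]_i=\mu_i(Tx,y)-\mu_i(Ty,x),\qquad i\in\{1,2\},\ x,y\in L.$$
   Context: All vector spaces are over a field $\mathbb{K}$ of characteristic $0$. An AssDer pair $(L,\mu,\delta)$ is an associative algebra $(L,\mu)$ with a linear map $\delta:L\to L$ such that $\delta\mu(x,y)=\mu(\delta x,y)+\mu(x,\delta y)$. A compatible AssDer pair $(L,\mu_1,\mu_2,\delta_1,\delta_2)$ consists of two AssDer pairs $(L,\mu_1,\delta_1)$, $(L,\mu_2,\delta_2)$ on the same vector space such that for all $x,y,z\in L$: (1) $\mu_2(\mu_1(x,y),z)+\mu_1(\mu_2(x,y),z)=\mu_1(x,\mu_2(y,z))+\mu_2(x,\mu_1(y,z))$; (2) $\delta_1(\mu_2(x,y))+\delta_2(\mu_1(x,y))=\mu_2(\delta_1x,y)+\mu_2(x,\delta_1y)+\mu_1(\delta_2x,y)+\mu_1(x,\delta_2y)$. A LieDer pair $(L,[\cdot,\cdot],\delta)$ is a Lie algebra with a linear map $\delta$ such that $\delta[x,y]=[\delta x,y]+[x,\delta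 y]$. A compatible LieDer pair $(L,[\cdot,\cdot]_1,[\cdot,\cdot]_2,\delta_1,\delta_2)$ consists of two LieDer pairs $(L,[\cdot,\cdot]_1,\delta_1)$, $(L,[\cdot,\cdot]_2,\delta_2)$ on the same vector space such that for all $x,y,z\in L$ (with $\circlearrowleft_{x,y,z}$ the sum over cyclic permutations of $x,y,z$): (1) $\circlearrowleft_{x,y,z}[x,[y,z]_1]_2+\circlearrowleft_{x,y,z}[x,[y,z]_2]_1=0$; (2) $\delta_1[x,y]_2+\delta_2[x,y]_1=[\delta_1x,y]_2+[x,\delta_1y]_2+[\delta_2x,y]_1+[x,\delta_2y]_1$. *)

theory Defs
  imports Complex_Main
begin

text \<open>
  A vector space is a type \<open>'v\<close> of class \<open>ab_group_add\<close> with a scalar multiplication \<open>scale\<close>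
  (locale \<open>vector_space\<close>); the characteristic of the ground field is fixed by the class
  \<open>field_char_0\<close>. No dimension restriction is made, and algebras need not be unital.
\<close>

locale bilinear_operation = vector_space scale
  for scale :: "'k::field_char_0 \<Rightarrow> 'v::ab_group_add \<Rightarrow> 'v"
    and m :: "'v \<Rightarrow> 'v \<Rightarrow> 'v" +
  assumes linear_left: "Vector_Spaces.linear scale scale (\<lambda>x. m x y)"
    and linear_right: "Vector_Spaces.linear scale scale (\<lambda>y. m x y)"

locale associative_algebra = bilinear_operation scale \<mu>
  for scale :: "'k::field_char_0 \<Rightarrow> 'v::ab_group_add \<Rightarrow> 'v"
    and \<mu> :: "'v \<Rightarrow> 'v \<Rightarrow> 'v" +
  assumes assoc: "\<mu> (\<mu> x y) z = \<mu> x (\<mu> y z)"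

locale Lie_algebra = bilinear_operation scale br
  for scale :: "'k::field_char_0 \<Rightarrow> 'v::ab_group_add \<Rightarrow> 'v"
    and br :: "'v \<Rightarrow> 'v \<Rightarrow> 'v" +
  assumes alternating: "br x x = 0"
    and Jacobi: "br x (br y z) + br y (br z x) + br z (br x y) = 0"

locale AssDer_pair = associative_algebra scale \<mu>
  for scale :: "'k::field_char_0 \<Rightarrow> 'v::ab_group_add \<Rightarrow> 'v"
    and \<mu> :: "'v \<Rightarrow> 'v \<Rightarrow> 'v" and \<delta> :: "'v \<Rightarrow> 'v" +
  assumes linear_der: "Vector_Spaces.linear scale scale \<delta>"
    and derivation: "\<delta> (\<mu> x y) = \<mu> (\<delta> x) y + \<mu> x (\<delta> y)"

locale LieDer_pair = Lie_algebra scale br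
  for scale :: "'k::field_char_0 \<Rightarrow> 'v::ab_group_add \<Rightarrow> 'v"
    and br :: "'v \<Rightarrow> 'v \<Rightarrow> 'v" and \<delta> :: "'v \<Rightarrow> 'v" +
  assumes linear_der: "Vector_Spaces.linear scale scale \<delta>"
    and derivation: "\<delta> (br x y) = br (\<delta> x) y + br x (\<delta> y)"

locale compatible_AssDer_pair =
  A1: AssDer_pair scale \<mu>\<^sub>1 \<delta>\<^sub>1 + A2: AssDer_pair scale \<mu>\<^sub>2 \<delta>\<^sub>2
  for scale :: "'k::field_char_0 \<Rightarrow> 'v::ab_group_add \<Rightarrow> 'v"
    and \<mu>\<^sub>1 \<mu>\<^sub>2 :: "'v \<Rightarrow> 'v \<Rightarrow> 'v" and \<delta>\<^sub>1 \<delta>\<^sub>2 :: "'v \<Rightarrow> 'v" +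
  assumes compatible_mult:
      "\<mu>\<^sub>2 (\<mu>\<^sub>1 x y) z + \<mu>\<^sub>1 (\<mu>\<^sub>2 x y) z = \<mu>\<^sub>1 x (\<mu>\<^sub>2 y z) + \<mu>\<^sub>2 x (\<mu>\<^sub>1 y z)"
    and compatible_der:
      "\<delta>\<^sub>1 (\<mu>\<^sub>2 x y) + \<delta>\<^sub>2 (\<mu>\<^sub>1 x y) =
         \<mu>\<^sub>2 (\<delta>\<^sub>1 x) y + \<mu>\<^sub>2 x (\<delta>\<^sub>1 y) + \<mu>\<^sub>1 (\<delta>\<^sub>2 x) y + \<mu>\<^sub>1 x (\<delta>\<^sub>2 y)"

locale compatible_LieDer_pair =
  L1: LieDer_pair scale br\<^sub>1 \<delta>\<^sub>1 + L2: LieDer_pair scale br\<^sub>2 \<delta>\<^sub>2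
  for scale :: "'k::field_char_0 \<Rightarrow> 'v::ab_group_add \<Rightarrow> 'v"
    and br\<^sub>1 br\<^sub>2 :: "'v \<Rightarrow> 'v \<Rightarrow> 'v" and \<delta>\<^sub>1 \<delta>\<^sub>2 :: "'v \<Rightarrow> 'v" +
  assumes compatible_bracket:
      "(br\<^sub>2 x (br\<^sub>1 y z) + br\<^sub>2 y (br\<^sub>1 z x) + br\<^sub>2 z (br\<^sub>1 x y)) +
       (br\<^sub>1 x (br\<^sub>2 y z) + br\<^sub>1 y (br\<^sub>2 z x) + br\<^sub>1 z (br\<^sub>2 x y)) = 0"
    and compatible_der:
      "\<delta>\<^sub>1 (br\<^sub>2 x y) + \<delta>\<^sub>2 (br\<^sub>1 x y) =
         br\<^sub>2 (\<delta>\<^sub>1 x) y + br\<^sub>2 x (\<delta>\<^sub>1 y) + br\<^sub>1 (\<delta>\<^sub>2 x) y + br\<^sub>1 x (\<delta>\<^sub>2 y)"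

definition endomorphism_operator ::
  "('k::field_char_0 \<Rightarrow> 'v::ab_group_add \<Rightarrow> 'v) \<Rightarrow> ('v \<Rightarrow> 'v \<Rightarrow> 'v) \<Rightarrow> ('v \<Rightarrow> 'v \<Rightarrow> 'v) \<Rightarrow>
   ('v \<Rightarrow> 'v) \<Rightarrow> bool"
  where "endomorphism_operator scale \<mu>\<^sub>1 \<mu>\<^sub>2 T \<longleftrightarrow>
    Vector_Spaces.linear scale scale T \<and>
    (\<forall>x y. T (\<mu>\<^sub>1 x y) = \<mu>\<^sub>1 (T x) (T y)) \<and>
    (\<forall>x y. T (\<mu>\<^sub>2 x y) = \<mu>\<^sub>2 (T x) (T y))"

end

theory Submission
  imports Defs
begin

text \<open>
  The product \<open>x \<star>\<^sub>i y = \<mu>\<^sub>i (T x) y\<close> is again associative, because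
  \<open>T (T x) = T x\<close> and \<open>T\<close> is multiplicative, and all the identities of a compatible AssDer pair
  for \<open>\<star>\<^sub>1, \<star>\<^sub>2\<close> are those for \<open>\<mu>\<^sub>1, \<mu>\<^sub>2\<close> evaluated at \<open>T x, T y, z\<close>.
  The brackets in question are the commutators of \<open>\<star>\<^sub>1, \<star>\<^sub>2\<close>.
\<close>

context bilinear_operation
begin

lemma add_left: "m (x + y) z = m x z + m y z"
  and diff_left: "m (x - y) z = m x z - m y z"
  and scale_left: "m (scale c x) z = scale c (m x z)"
proof -
  interpret left: Vector_Spaces.linear scale scale "\<lambda>x. m x z" by (rule linear_left)
  show "m (x + y) z = m x z + m y z" "m (x - y) z = m x z - m y z"
    "m (scale c x) z = scale c (m x z)"
    by (rule left.add left.diff left.scale)+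
qed

lemma add_right: "m z (x + y) = m z x + m z y"
  and diff_right: "m z (x - y) = m z x - m z y"
  and scale_right: "m z (scale c x) = scale c (m z x)"
proof -
  interpret right: Vector_Spaces.linear scale scale "\<lambda>x. m z x" by (rule linear_right)
  show "m z (x + y) = m z x + m z y" "m z (x - y) = m z x - m z y"
    "m z (scale c x) = scale c (m z x)"
    by (rule right.add right.diff right.scale)+
qed

lemmas bilinear_simps = add_left diff_left scale_left add_right diff_right scale_right

lemma bilinear_operation_commutator: "bilinear_operation scale (\<lambda>x y. m x y - m y x)"
  by unfold_locales (simp_all add: bilinear_simps algebra_simps scale_right_diff_distrib)

lemma bilinear_operation_compose_left:
  assumes "Vector_Spaces.linear scale scale T"
  shows "bilinear_operation scale (\<lambda>x y. m (T x) y)"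
proof -
  interpret T: Vector_Spaces.linear scale scale T by fact
  show ?thesis
    by unfold_locales (simp_all add: bilinear_simps T.add T.scale)
qed

end

text \<open>Both sides of associativity become \<open>\<mu> (\<mu> (T x) (T y)) z\<close> by
  \<open>mult\<close>, \<open>idem\<close> and \<open>assoc\<close>. The Leibniz rule is that of
  \<mu> at \<open>T x\<close> and \<open>y\<close>: it produces \<open>\<delta> (T x)\<close>, which
  \<open>comm\<close> identifies with \<open>T (\<delta> x)\<close>.\<close>

lemma (in AssDer_pair) AssDer_pair_compose_left:
  assumes lin: "Vector_Spaces.linear scale scale T"
    and mult: "\<And>x y. T (\<mu> x y) = \<mu> (T x) (T y)"
    and idem: "\<And>x. T (T x) = T x"
    and comm: "\<And>x. T (\<delta> x) = \<delta> (T x)"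
  shows "AssDer_pair scale (\<lambda>x y. \<mu> (T x) y) \<delta>"
proof -
  \<comment> \<open>Registering bilinearity first lets \<open>unfold_locales\<close> discharge
    it.\<close>
  interpret star: bilinear_operation scale "\<lambda>x y. \<mu> (T x) y"
    using lin by (rule bilinear_operation_compose_left)
  interpret der: Vector_Spaces.linear scale scale \<delta> by (rule linear_der)
  show ?thesis
    by unfold_locales (simp_all add: mult idem comm assoc derivation der.add der.scale)
qed

text \<open>In the Jacobi sum every product of the three elements, in each of the six orders, occurs
  once with each sign after rebracketing by \<open>assoc\<close>. The Leibniz rule is
  antisymmetrized term by term.\<close>

lemma (in AssDer_pair) LieDer_pair_commutator:
  "LieDer_pair scale (\<lambda>x y. \<mu> x y - \<mu> y x) \<delta>"
proof -
  interpret der: Vector_Spaces.linear scale scale \<delta> by (rule linear_der)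
  interpret bracket: bilinear_operation scale "\<lambda>x y. \<mu> x y - \<mu> y x"
    by (rule bilinear_operation_commutator)
  show ?thesis
    by unfold_locales
      (simp_all add: bilinear_simps assoc derivation der.add der.diff der.scale algebra_simps)
qed

context compatible_AssDer_pair
begin

text \<open>As for a single product, T passes through the inner product in the mixed associativity
  condition. The mixed Leibniz condition only involves \<open>T x\<close> and \<open>y\<close>, once
  each derivation is moved past T.\<close>

lemma compatible_AssDer_pair_compose_left:
  assumes lin: "Vector_Spaces.linear scale scale T"
    and mult: "\<And>x y. T (\<mu>\<^sub>1 x y) = \<mu>\<^sub>1 (T x) (T y)" "\<And>x y. T (\<mu>\<^sub>2 x y) = \<mu>\<^sub>2 (T x) (T y)"
    and idem: "\<And>x. T (T x) = T x"
    and comm: "\<And>x. T (\<delta>\<^sub>1 x) = \<delta>\<^sub>1 (T x)" "\<And>x. T (\<delta>\<^sub>2 x) = \<delta>\<^sub>2 (T x)"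
  shows "compatible_AssDer_pair scale (\<lambda>x y. \<mu>\<^sub>1 (T x) y) (\<lambda>x y. \<mu>\<^sub>2 (T x) y) \<delta>\<^sub>1 \<delta>\<^sub>2"
proof -
  interpret star1: AssDer_pair scale "\<lambda>x y. \<mu>\<^sub>1 (T x) y" \<delta>\<^sub>1
    using lin mult(1) idem comm(1) by (rule A1.AssDer_pair_compose_left)
  interpret star2: AssDer_pair scale "\<lambda>x y. \<mu>\<^sub>2 (T x) y" \<delta>\<^sub>2
    using lin mult(2) idem comm(2) by (rule A2.AssDer_pair_compose_left)
  show ?thesis
    by unfold_locales (simp_all add: mult idem comm compatible_mult compatible_der)
qed

text \<open>The mixed Jacobi sum has 24 terms. They group into six instances of
  \<open>compatible_mult\<close>, one for each order of x, y, z, weighted by the sign of the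
  permutation. The mixed Leibniz condition is the difference of \<open>compatible_der\<close> at (x,
  y) and at (y, x).\<close>

lemma compatible_LieDer_pair_commutator:
  "compatible_LieDer_pair scale (\<lambda>x y. \<mu>\<^sub>1 x y - \<mu>\<^sub>1 y x) (\<lambda>x y. \<mu>\<^sub>2 x y - \<mu>\<^sub>2 y x) \<delta>\<^sub>1 \<delta>\<^sub>2"
proof -
  interpret der1: Vector_Spaces.linear scale scale \<delta>\<^sub>1 by (rule A1.linear_der)
  interpret der2: Vector_Spaces.linear scale scale \<delta>\<^sub>2 by (rule A2.linear_der)
  interpret bracket1: LieDer_pair scale "\<lambda>x y. \<mu>\<^sub>1 x y - \<mu>\<^sub>1 y x" \<delta>\<^sub>1
    by (rule A1.LieDer_pair_commutator)
  interpret bracket2: LieDer_pair scale "\<lambda>x y. \<mu>\<^sub>2 x y - \<mu>\<^sub>2 y x" \<delta>\<^sub>2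
    by (rule A2.LieDer_pair_commutator)
  \<comment> \<open>An equation between sums does not rewrite inside longer sums. Here and in
    \<open>der\<close> the condition is solved for a single term, so that rewriting eliminates that
    term and the rest cancels in the abelian group.\<close>
  have mult: "\<mu>\<^sub>2 (\<mu>\<^sub>1 x y) z = \<mu>\<^sub>1 x (\<mu>\<^sub>2 y z) + \<mu>\<^sub>2 x (\<mu>\<^sub>1 y z) - \<mu>\<^sub>1 (\<mu>\<^sub>2 x y) z" for x y z
    using compatible_mult[of x y z] by (simp add: eq_diff_eq)
  have der: "\<delta>\<^sub>1 (\<mu>\<^sub>2 x y) =
      \<mu>\<^sub>2 (\<delta>\<^sub>1 x) y + \<mu>\<^sub>2 x (\<delta>\<^sub>1 y) + \<mu>\<^sub>1 (\<delta>\<^sub>2 x) y + \<mu>\<^sub>1 x (\<delta>\<^sub>2 y) - \<delta>\<^sub>2 (\<mu>\<^sub>1 x y)" for x y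
    using compatible_der[of x y] by (simp add: eq_diff_eq)
  show ?thesis
    by unfold_locales
      (simp_all add: A1.bilinear_simps A2.bilinear_simps der1.diff der2.diff mult der algebra_simps)
qed

end

theorem proposition4p6:
  fixes scale :: "'k::field_char_0 \<Rightarrow> 'v::ab_group_add \<Rightarrow> 'v"
    and \<mu>\<^sub>1 \<mu>\<^sub>2 :: "'v \<Rightarrow> 'v \<Rightarrow> 'v"
    and \<delta>\<^sub>1 \<delta>\<^sub>2 T :: "'v \<Rightarrow> 'v"
  assumes "compatible_AssDer_pair scale \<mu>\<^sub>1 \<mu>\<^sub>2 \<delta>\<^sub>1 \<delta>\<^sub>2"
    and "endomorphism_operator scale \<mu>\<^sub>1 \<mu>\<^sub>2 T"
    and "\<And>x. T (T x) = T x"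
    and "T \<circ> \<delta>\<^sub>1 = \<delta>\<^sub>1 \<circ> T"
    and "T \<circ> \<delta>\<^sub>2 = \<delta>\<^sub>2 \<circ> T"
  shows "compatible_LieDer_pair scale
    (\<lambda>x y. \<mu>\<^sub>1 (T x) y - \<mu>\<^sub>1 (T y) x)
    (\<lambda>x y. \<mu>\<^sub>2 (T x) y - \<mu>\<^sub>2 (T y) x)
    \<delta>\<^sub>1 \<delta>\<^sub>2"
proof -
  interpret compatible_AssDer_pair scale \<mu>\<^sub>1 \<mu>\<^sub>2 \<delta>\<^sub>1 \<delta>\<^sub>2 by fact
  interpret star: compatible_AssDer_pair scale
    "\<lambda>x y. \<mu>\<^sub>1 (T x) y" "\<lambda>x y. \<mu>\<^sub>2 (T x) y" \<delta>\<^sub>1 \<delta>\<^sub>2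
    using assms by (intro compatible_AssDer_pair_compose_left)
      (simp_all add: endomorphism_operator_def fun_eq_iff)
  show ?thesis
    by (rule star.compatible_LieDer_pair_commutator)
qed

end
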